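(* Let $q\in[0,1]$ and $\boldsymbol\delta=(\delta_1,\dots,\delta_p)^\top$ with all $\delta_j\ge 0$. Assume that $\mathbf G=[\mathbf X\ \tilde{\mathbf X}]^\top[\mathbf X\ \tilde{\mathbf X}]$ is invertible, let $\hat{\boldsymbol\beta}_{\mathsf{OLS}}=\mathbf G^{-1}[\mathbf X\ \tilde{\mathbf X}]^\top\mathbf y\in\mathbb R^{2p}$, and define $$\hat{\boldsymbol\beta}_{\mathsf{S\text{-}OLS}}=\hat{\boldsymbol\beta}_{\mathsf{OLS}}+\begin{pmatrix}\mathbf 0_{p\times1}\\ \boldsymbol\delta_{p\times 1}\end{pmatrix}.$$ Let $\hat\beta_j$ and $\hat\beta_j'$ denote the $j$-th and $(j+p)$-th entries of $\hat{\boldsymbol\beta}_{\mathsf{S\text{-}OLS}}$, $1\le j\le p$. Consider the knockoff procedure with target FDR $q$ applied to statistics $W_1,\dots,W_p$ computed from $\hat{\boldsymbol\beta}_{\mathsf{S\text{-}OLS}}$. (I) (One-sided test.) Consider testing $\mathsf H'_{0,j}:\beta_j\le\delta_j$, $1\le j\le p$. If, for every $j$, $|W_j|$ depends on $\hat{\boldsymbol\beta}_{\mathsf{S\text{-}OLS}}$ only through the unordered pair $\{\hat\beta_j,\hat\beta_j'\}$ and $\mathrm{sgn}(W_j)=\mathrm{sgn}(\hat\beta_j-\hat\beta_j')$, then the procedure controls the FDR at level $q$; that is, the FDR with respect to the set of true nulls $\{j:\beta_j\le\delta_j\}$ is at most $q$. (II) (Approximate two-sided test.) Consider testing $\breve{\mathsf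 H}_{0,j}:|\beta_j|\le\delta_j$, $1\le j\le p$, and let $\breve{\mathcal H}_0=\{j:|\beta_j|\le\delta_j\}$. If, for every $j$, $|W_j|$ depends on $\hat{\boldsymbol\beta}_{\mathsf{S\text{-}OLS}}$ only through the unordered pair $\{\hat\beta_j,\hat\beta_j'\}$ and $\mathrm{sgn}(W_j)=\mathrm{sgn}(|\hat\beta_j|-|\hat\beta_j'|)$, then the FDR with respect to $\breve{\mathcal H}_0$ satisfies $$\mathsf{FDR}\le q+\mathbb P\Big\{\min_{j\in\breve{\mathcal H}_0}(\hat\beta_j+\hat\beta_j')<0\Big\}.$$
   Context: Model: $\mathbf y=\mathbf X\boldsymbol\beta+\mathbf w$ with $\mathbf w\sim\mathcal N(0,\sigma^2\mathbf I_n)$, $\sigma^2>0$, $\mathbf X=[\mathbf X_1,\dots,\mathbf X_p]\in\mathbb R^{n\times p}$ a fixed (deterministic) design with $n\ge 2p$, columns of Euclidean norm $1$, and $\boldsymbol\Sigma=\mathbf X^\top\mathbf X$ invertible; $\boldsymbol\beta=(\beta_1,\dots,\beta_p)^\top\in\mathbb R^p$ is a fixed unknown vector. Knockoff matrix: fix $\mathbf s\in\mathbb R^p_+$ with $\mathrm{diag}(\mathbf s)\preceq 2\boldsymbol\Sigma$, and let $\tilde{\mathbf X}=\mathbf X(\mathbf I_p-\boldsymbol\Sigma^{-1}\mathrm{diag}(\mathbf s))+\tilde{\mathbf U}\mathbf C$, where $\tilde{\mathbf U}\in\mathbb R^{n\times p}$ has orthonormal columns with $\tilde{\mathbf U}^\top\mathbf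 X=0$, and $\mathbf C^\top\mathbf C=2\,\mathrm{diag}(\mathbf s)-\mathrm{diag}(\mathbf s)\boldsymbol\Sigma^{-1}\mathrm{diag}(\mathbf s)$. Then $$\mathbf G=[\mathbf X\ \tilde{\mathbf X}]^\top[\mathbf X\ \tilde{\mathbf X}]=\begin{bmatrix}\boldsymbol\Sigma&\boldsymbol\Sigma-\mathrm{diag}(\mathbf s)\\ \boldsymbol\Sigma-\mathrm{diag}(\mathbf s)&\boldsymbol\Sigma\end{bmatrix}.$$ Knockoff procedure with target FDR $q$: given real statistics $W_1,\dots,W_p$, let $\Phi=\{|W_j|:1\le j\le p\}\setminus\{0\}$ and $$T=\inf\Big\{t\in\Phi:\frac{1+\#\{j:W_j\le -t\}}{\#\{j:W_j\ge t\}\vee 1}\le q\Big\}$$ (with $\inf\emptyset=+\infty$); the procedure rejects (selects) $\mathcal R=\{j:W_j\ge T\}$. FDR: for a set $\mathcal H\subseteq\{1,\dots,p\}$ of indices of true null hypotheses, the FDR of a selected set $\mathcal R$ is $\mathsf{FDR}=\mathbb E\big(|\mathcal R\cap\mathcal H|/(|\mathcal R|\vee1)\big)$. Here $\mathrm{sgn}(0)=0$. *)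

theory Defs
  imports "HOL-Probability.Probability"
begin

definition diag :: "real^'a \<Rightarrow> real^'a^'a" where
  "diag s = (\<chi> i j. if i = j then s $ i else 0)"

definition psd :: "real^'a^'a \<Rightarrow> bool" where
  "psd A \<longleftrightarrow> transpose A = A \<and> (\<forall>v. 0 \<le> v \<bullet> (A *v v))"

definition loewner_le :: "real^'a^'a \<Rightarrow> real^'a^'a \<Rightarrow> bool" where
  "loewner_le A B \<longleftrightarrow> psd (B - A)"

text \<open>The index type of the 2p columns of a block matrix is \<open>'p + 'p\<close>: \<open>Inl j\<close> is the j-th
  and \<open>Inr j\<close> the (j+p)-th index.\<close>

definition hcat :: "real^'a^'n \<Rightarrow> real^'b^'n \<Rightarrow> real^('a + 'b)^'n" where
  "hcat A B = (\<chi> i k. case k of Inl j \<Rightarrow> A $ i $ j | Inr j \<Rightarrow> B $ i $ j)"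

definition vcat :: "real^'a \<Rightarrow> real^'b \<Rightarrow> real^('a + 'b)" where
  "vcat u v = (\<chi> k. case k of Inl j \<Rightarrow> u $ j | Inr j \<Rightarrow> v $ j)"

text \<open>Density of the multivariate normal distribution with mean \<open>\<mu>\<close> and positive definite
  covariance matrix \<open>S\<close>.\<close>

definition mvn_density :: "real^'n \<Rightarrow> real^'n^'n \<Rightarrow> real^'n \<Rightarrow> real" where
  "mvn_density \<mu> S x =
     exp (- ((x - \<mu>) \<bullet> (matrix_inv S *v (x - \<mu>))) / 2) / sqrt ((2 * pi) ^ CARD('n) * det S)"

definition ols :: "real^'k^'n \<Rightarrow> real^'n \<Rightarrow> real^'k" where
  "ols A y = matrix_inv (transpose A ** A) *v (transpose A *v y)"

text \<open>The threshold is an extended real, so that it is \<open>\<infinity>\<close> (and nothing is rejected) when no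
  candidate qualifies.\<close>

definition knockoff_threshold :: "real \<Rightarrow> ('p::finite \<Rightarrow> real) \<Rightarrow> ereal" where
  "knockoff_threshold q W =
     Inf (ereal ` {t \<in> range (\<lambda>j. \<bar>W j\<bar>) - {0}.
       (1 + real (card {j. W j \<le> - t})) / real (max (card {j. t \<le> W j}) 1) \<le> q})"

definition knockoff_select :: "real \<Rightarrow> ('p::finite \<Rightarrow> real) \<Rightarrow> 'p set" where
  "knockoff_select q W = {j. knockoff_threshold q W \<le> ereal (W j)}"

definition FDR :: "'w measure \<Rightarrow> 'p::finite set \<Rightarrow> ('w \<Rightarrow> 'p set) \<Rightarrow> real" where
  "FDR M H R = (\<integral>\<omega>. real (card (R \<omega> \<inter> H)) / real (max (card (R \<omega>)) 1) \<partial>M)"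

end

theory Submission
  imports Defs
begin

text \<open>
  Let \<open>f\<^sub>j\<close> be \<open>1\<close> at \<open>j\<close>, \<open>-1\<close> at \<open>j + p\<close> and \<open>0\<close> elsewhere. It is an eigenvector of the Gram
  matrix with eigenvalue \<open>s\<^sub>j\<close>, so reflecting the noise along \<open>u\<^sub>j = X\<^sub>j - Xt\<^sub>j\<close> (and translating)
  exchanges the \<open>j\<close>-th and \<open>(j + p)\<close>-th entries of the shifted OLS estimate and fixes all others.
  The reflection preserves Lebesgue measure, and it does not decrease the Gaussian density where
  the difference of the two entries is positive if \<open>\<beta>\<^sub>j \<le> \<delta>\<^sub>j\<close>. No conditioning on the magnitudes
  of the statistics is needed: the false discovery proportion is at most \<open>q\<close> times a sum over the
  nulls with \<open>W\<^sub>j > 0\<close> of weights that do not depend on the sign of \<open>W\<^sub>j\<close>; reflecting each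
  summand turns it into the sum over the nulls with \<open>W\<^sub>j < 0\<close>, which is pointwise at most \<open>1\<close>.
  In part (II) the same argument applies on the event that the sums
  of the paired entries are nonnegative for all nulls.
\<close>

section \<open>Leave-one-out bound for the knockoff procedure\<close>

text \<open>The candidates of the infimum defining the threshold, named so that one candidate
  \<open>t\<close> can be carried from one vector of statistics to another.\<close>

definition admissible :: "real \<Rightarrow> ('p::finite \<Rightarrow> real) \<Rightarrow> real \<Rightarrow> bool" where
  "admissible q W t \<longleftrightarrow> t \<in> range (\<lambda>j. \<bar>W j\<bar>) - {0} \<and>
     (1 + real (card {j. W j \<le> - t})) / real (max (card {j. t \<le> W j}) 1) \<le> q"

lemma admissible_pos: "admissible q W t \<Longrightarrow> 0 < t"
  by (auto simp: admissible_def)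

lemma finite_admissible: "finite {t. admissible q W t}"
  by (rule finite_subset[of _ "range (\<lambda>j. \<bar>W j\<bar>)"]) (auto simp: admissible_def)

lemma knockoff_threshold_eq: "knockoff_threshold q W = Inf (ereal ` {t. admissible q W t})"
  unfolding knockoff_threshold_def admissible_def by (rule arg_cong[of _ _ Inf]) auto

text \<open>Candidates are among the finitely many values of \<open>\<bar>W j\<bar>\<close>, so the
  infimum is a minimum unless there are none. Hence a finite threshold itself satisfies the ratio
  bound.\<close>

lemma knockoff_threshold_cases:
  obtains (infinite) "knockoff_threshold q W = \<infinity>" "\<And>t. \<not> admissible q W t"
  | (attained) t where "knockoff_threshold q W = ereal t" "admissible q W t"
proof (cases "{t. admissible q W t} = {}")
  case True
  then show ?thesis
    using infinite by (simp add: knockoff_threshold_eq top_ereal_def)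
next
  case False
  then have "knockoff_threshold q W = Min (ereal ` {t. admissible q W t})"
    unfolding knockoff_threshold_eq by (intro cInf_eq_Min finite_imageI finite_admissible) simp
  moreover have "Min (ereal ` {t. admissible q W t}) \<in> ereal ` {t. admissible q W t}"
    using False by (intro Min_in finite_imageI finite_admissible) simp
  ultimately show ?thesis
    using attained by auto
qed

lemma knockoff_threshold_le: "admissible q W t \<Longrightarrow> knockoff_threshold q W \<le> ereal t"
  unfolding knockoff_threshold_eq by (rule Inf_lower) simp

section \<open>Measurability of the threshold\<close>

lemma borel_measurable_card_Collect:
  fixes P :: "'p::finite \<Rightarrow> 'a \<Rightarrow> bool"
  assumes [measurable]: "\<And>j. Measurable.pred N (P j)"
  shows "(\<lambda>x. real (card {j. P j x})) \<in> borel_measurable N"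
proof -
  have "(\<lambda>x. real (card {j. P j x})) = (\<lambda>x. \<Sum>j\<in>UNIV. if P j x then 1 else 0)"
    by (simp add: sum.If_cases)
  then show ?thesis
    by simp
qed

lemma borel_measurable_knockoff_threshold:
  fixes W :: "'p::finite \<Rightarrow> 'a \<Rightarrow> real"
  assumes [measurable]: "\<And>j. W j \<in> borel_measurable N"
  shows "(\<lambda>x. knockoff_threshold q (\<lambda>j. W j x)) \<in> borel_measurable N"
proof -
  note borel_measurable_card_Collect[measurable]
  \<comment> \<open>The candidate set varies with the sample point. Indexing the infimum by the
    fixed finite type, with the neutral value \<open>\<infinity>\<close> for inadmissible entries,
    makes it measurable.\<close>
  have threshold: "knockoff_threshold q V = (INF k. if admissible q V \<bar>V k\<bar> then ereal \<bar>V k\<bar> else \<infinity>)"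
    for V :: "'p \<Rightarrow> real"
  proof (rule antisym)
    show "knockoff_threshold q V \<le> (INF k. if admissible q V \<bar>V k\<bar> then ereal \<bar>V k\<bar> else \<infinity>)"
      by (rule INF_greatest) (simp add: knockoff_threshold_le)
    show "(INF k. if admissible q V \<bar>V k\<bar> then ereal \<bar>V k\<bar> else \<infinity>) \<le> knockoff_threshold q V"
    proof (cases rule: knockoff_threshold_cases[of q V])
      case (attained t)
      then obtain k where "t = \<bar>V k\<bar>"
        by (auto simp: admissible_def)
      with attained show ?thesis
        by (intro INF_lower2[of k]) auto
    qed simp
  qed
  have "admissible q (\<lambda>j. W j x) \<bar>W k x\<bar> \<longleftrightarrow> W k x \<noteq> 0 \<and>
      (1 + real (card {j. W j x \<le> - \<bar>W k x\<bar>})) / max (real (card {j. \<bar>W k x\<bar> \<le> W j x})) 1 \<le> q"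
    for k x
    by (auto simp: admissible_def of_nat_max)
  then have [measurable]: "Measurable.pred N (\<lambda>x. admissible q (\<lambda>j. W j x) \<bar>W k x\<bar>)" for k
    by simp
  show ?thesis
    unfolding threshold by measurable
qed

section \<open>False discovery proportion and its leave-one-out bounds\<close>

definition fdp :: "'p::finite set \<Rightarrow> 'p set \<Rightarrow> real" where
  "fdp H R = real (card (R \<inter> H)) / real (max (card R) 1)"

lemma fdp_nonneg: "0 \<le> fdp H R"
  by (simp add: fdp_def)

lemma fdp_le_1: "fdp H R \<le> 1"
  using card_mono[of R "R \<inter> H"] by (auto simp: fdp_def divide_le_eq_1)

lemma borel_measurable_fdp:
  fixes W :: "'p::finite \<Rightarrow> 'a \<Rightarrow> real"
  assumes [measurable]: "\<And>j. W j \<in> borel_measurable N"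
  shows "(\<lambda>x. fdp H (knockoff_select q (\<lambda>j. W j x))) \<in> borel_measurable N"
proof -
  note borel_measurable_card_Collect[measurable] borel_measurable_knockoff_threshold[measurable]
  have "fdp H (knockoff_select q V) =
      real (card {j. knockoff_threshold q V \<le> ereal (V j) \<and> j \<in> H}) /
      max (real (card {j. knockoff_threshold q V \<le> ereal (V j)})) 1" for V :: "'p \<Rightarrow> real"
    by (simp add: fdp_def knockoff_select_def of_nat_max Int_def)
  then show ?thesis
    by simp
qed

text \<open>Making the sign of \<open>W j\<close> positive does not change the procedure when \<open>j\<close> is selected, and
  makes the following weight independent of the sign of \<open>W j\<close>.\<close>

definition loo_weight :: "real \<Rightarrow> 'p::finite set \<Rightarrow> 'p \<Rightarrow> ('p \<Rightarrow> real) \<Rightarrow> real" where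
  "loo_weight q H j W = (let W' = W(j := \<bar>W j\<bar>); T = knockoff_threshold q W' in
     (if T \<le> ereal \<bar>W j\<bar> then 1 / (1 + real (card {k \<in> H. T \<le> ereal (- W' k)})) else 0))"

lemma loo_weight_nonneg: "0 \<le> loo_weight q H j W"
  by (simp add: loo_weight_def Let_def)

lemma loo_weight_cong:
  assumes "\<bar>W j\<bar> = \<bar>W' j\<bar>" "\<And>k. k \<noteq> j \<Longrightarrow> W k = W' k"
  shows "loo_weight q H j W = loo_weight q H j W'"
proof -
  have "W(j := \<bar>W j\<bar>) = W'(j := \<bar>W' j\<bar>)"
    using assms by auto
  with assms show ?thesis
    unfolding loo_weight_def by simp
qed

lemma borel_measurable_loo_weight:
  fixes W :: "'p::finite \<Rightarrow> 'a \<Rightarrow> real"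
  assumes [measurable]: "\<And>j. W j \<in> borel_measurable N"
  shows "(\<lambda>x. loo_weight q H j (\<lambda>k. W k x)) \<in> borel_measurable N"
proof -
  note borel_measurable_card_Collect[measurable]
  define W' where "W' k x = (if k = j then \<bar>W j x\<bar> else W k x)" for k x
  have [measurable]: "W' k \<in> borel_measurable N" for k
    by (cases "k = j") (simp_all add: W'_def[abs_def])
  have [measurable]: "(\<lambda>x. knockoff_threshold q (\<lambda>k. W' k x)) \<in> borel_measurable N"
    by (rule borel_measurable_knockoff_threshold) measurable
  have upd: "(\<lambda>k. W k x)(j := \<bar>W j x\<bar>) = (\<lambda>k. W' k x)" for x
    by (auto simp: W'_def)
  show ?thesis
    unfolding loo_weight_def Let_def upd by measurable
qed

text \<open>Admissibility of the threshold \<open>t\<close> gives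
  \<open>1 / max (card R) 1 \<le> q / (1 + n)\<close>, even with \<open>n\<close> counting only the
  nulls below \<open>- t\<close>. A selected null has \<open>W j \<ge> t > 0\<close>, so the update
  at \<open>j\<close> changes nothing and its weight is exactly \<open>1 / (1 + n)\<close>.\<close>

lemma fdp_le_sum_loo_weight:
  fixes W :: "'p::finite \<Rightarrow> real"
  assumes "0 \<le> q"
  shows "fdp H (knockoff_select q W) \<le> q * (\<Sum>j\<in>H. if 0 < W j then loo_weight q H j W else 0)"
proof (cases rule: knockoff_threshold_cases[of q W])
  case infinite
  then show ?thesis
    using assms by (auto simp: fdp_def knockoff_select_def loo_weight_nonneg intro!: mult_nonneg_nonneg sum_nonneg)
next
  case (attained t)
  define R where "R = knockoff_select q W"
  define n where "n = card {k \<in> H. W k \<le> - t}"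
  have R: "R = {j. t \<le> W j}"
    by (simp add: R_def knockoff_select_def attained(1))
  have t: "0 < t"
    using attained(2) by (rule admissible_pos)
  have weight: "(if 0 < W j then loo_weight q H j W else 0) \<ge> (if j \<in> R then 1 / (1 + real n) else 0)" for j
  proof (cases "j \<in> R")
    case True
    then have "W(j := \<bar>W j\<bar>) = W" "0 < W j"
      using t by (auto simp: R)
    with True show ?thesis
      by (simp add: loo_weight_def attained(1) R n_def le_minus_iff)
  qed (simp add: loo_weight_nonneg)
  have "fdp H R \<le> q * (real (card (R \<inter> H)) * (1 / (1 + real n)))"
  proof -
    have "n \<le> card {j. W j \<le> - t}"
      unfolding n_def by (rule card_mono) auto
    then have "(1 + real n) / real (max (card R) 1) \<le> (1 + real (card {j. W j \<le> - t})) / real (max (card R) 1)"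
      by (intro divide_right_mono) auto
    also have "\<dots> \<le> q"
      using attained(2) by (simp add: admissible_def R)
    finally have "(1 / real (max (card R) 1)) \<le> q / (1 + real n)"
      by (simp add: field_simps)
    from mult_left_mono[OF this, of "real (card (R \<inter> H))"] show ?thesis
      by (simp add: fdp_def mult_ac)
  qed
  also have "real (card (R \<inter> H)) * (1 / (1 + real n)) = (\<Sum>j\<in>H. if j \<in> R then 1 / (1 + real n) else 0)"
    by (simp add: sum.If_cases Int_commute)
  also have "q * \<dots> \<le> q * (\<Sum>j\<in>H. if 0 < W j then loo_weight q H j W else 0)"
    using assms by (intro mult_left_mono sum_mono weight)
  finally show ?thesis
    by (simp add: R_def)
qed

text \<open>Making either of two entries below \<open>- t\<close> positive removes one index from
  the negative count, adds one to the positive count and keeps all magnitudes. Both updates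
  therefore give the same ratio at \<open>t\<close>.\<close>

lemma admissible_loo:
  fixes W :: "'p::finite \<Rightarrow> real"
  assumes t: "admissible q (W(j := \<bar>W j\<bar>)) t" and "W j \<le> - t" "W k \<le> - t"
  shows "admissible q (W(k := \<bar>W k\<bar>)) t"
proof -
  have pos: "0 < t"
    using t by (rule admissible_pos)
  have abs: "range (\<lambda>i. \<bar>(W(l := \<bar>W l\<bar>)) i\<bar>) = range (\<lambda>i. \<bar>W i\<bar>)" for l
    by (rule arg_cong[of _ _ range]) auto
  have neg: "card {i. (W(l := \<bar>W l\<bar>)) i \<le> - t} = card {i. W i \<le> - t} - 1" if "W l \<le> - t" for l
  proof -
    have "{i. (W(l := \<bar>W l\<bar>)) i \<le> - t} = {i. W i \<le> - t} - {l}"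
      using pos by auto
    with that show ?thesis
      by simp
  qed
  have positive: "card {i. t \<le> (W(l := \<bar>W l\<bar>)) i} = card {i. t \<le> W i} + 1" if "W l \<le> - t" for l
  proof -
    have "{i. t \<le> (W(l := \<bar>W l\<bar>)) i} = insert l {i. t \<le> W i}"
      using that by auto
    moreover have "l \<notin> {i. t \<le> W i}"
      using that pos by auto
    ultimately show ?thesis
      by simp
  qed
  show ?thesis
    using t unfolding admissible_def abs
    by (simp only: neg[OF assms(2)] neg[OF assms(3)] positive[OF assms(2)] positive[OF assms(3)])
qed

text \<open>All indices that contribute to the sum share one leave-one-out threshold \<open>t\<close>, so each
  contributes the reciprocal of the same number, which is at least the number of contributors.\<close>

lemma sum_loo_weight_le_1:
  fixes W :: "'p::finite \<Rightarrow> real"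
  shows "(\<Sum>j\<in>H. if W j < 0 then loo_weight q H j W else 0) \<le> 1"
proof -
  define T where "T j = knockoff_threshold q (W(j := \<bar>W j\<bar>))" for j
  define J where "J = {j \<in> H. W j < 0 \<and> T j \<le> ereal (- W j)}"
  \<comment> \<open>The smaller of the two thresholds lies below both \<open>- W j\<close> and
    \<open>- W k\<close>, so it is also admissible after the update at the other index. This forces
    equality.\<close>
  have T_le: "T k \<le> T j" if "j \<in> J" "k \<in> J" "T j \<le> T k" for j k
  proof (cases rule: knockoff_threshold_cases[of q "W(j := \<bar>W j\<bar>)"])
    case infinite
    with that show ?thesis
      by (simp add: J_def T_def)
  next
    case (attained t)
    have "ereal t \<le> ereal (- W j)" "ereal t \<le> ereal (- W k)"
    proof -
      have "T j \<le> ereal (- W j)" "T j \<le> ereal (- W k)"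
        using that by (auto simp: J_def intro: order_trans)
      then show "ereal t \<le> ereal (- W j)" "ereal t \<le> ereal (- W k)"
        by (simp_all add: T_def attained(1))
    qed
    then have "admissible q (W(k := \<bar>W k\<bar>)) t"
      by (intro admissible_loo[OF attained(2)]) auto
    then show ?thesis
      unfolding T_def attained(1) by (rule knockoff_threshold_le)
  qed
  then have T_eq: "T j = T k" if "j \<in> J" "k \<in> J" for j k
    using that by (metis linear order.antisym)
  have weight: "(if W j < 0 then loo_weight q H j W else 0) \<le> (if j \<in> J then 1 / real (card J) else 0)"
    if "j \<in> H" for j
  proof (cases "j \<in> J")
    case True
    \<comment> \<open>The update at \<open>j\<close> leaves the other members of \<open>J\<close>
      negative, and by the common threshold they are all counted. The \<open>1 +\<close> in the
      denominator of the weight makes up for \<open>j\<close> itself.\<close>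
    have "J - {j} \<subseteq> {k \<in> H. T j \<le> ereal (- (W(j := \<bar>W j\<bar>)) k)}"
      using T_eq[OF True] by (auto simp: J_def)
    then have "card (J - {j}) \<le> card {k \<in> H. T j \<le> ereal (- (W(j := \<bar>W j\<bar>)) k)}"
      by (intro card_mono) auto
    moreover have "card J = card (J - {j}) + 1"
      using card_Suc_Diff1[OF finite True] by simp
    ultimately have "real (card J) \<le> 1 + real (card {k \<in> H. T j \<le> ereal (- (W(j := \<bar>W j\<bar>)) k)})"
      by linarith
    moreover have "0 < card J"
      using True by (auto simp: card_gt_0_iff)
    ultimately have "1 / (1 + real (card {k \<in> H. T j \<le> ereal (- (W(j := \<bar>W j\<bar>)) k)})) \<le> 1 / real (card J)"
      by (intro divide_left_mono) auto
    moreover have "W j < 0" "T j \<le> ereal \<bar>W j\<bar>"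
      using True by (auto simp: J_def)
    ultimately show ?thesis
      using True unfolding loo_weight_def Let_def T_def[symmetric] by (simp only: if_True)
  next
    case False
    with that show ?thesis
      unfolding loo_weight_def Let_def T_def[symmetric] by (auto simp: J_def)
  qed
  have "(\<Sum>j\<in>H. if W j < 0 then loo_weight q H j W else 0) \<le> (\<Sum>j\<in>H. if j \<in> J then 1 / real (card J) else 0)"
    by (intro sum_mono weight)
  also have "\<dots> = real (card (H \<inter> J)) / real (card J)"
    by (simp add: sum.If_cases)
  also have "\<dots> \<le> 1"
    using card_mono[of J "H \<inter> J"] by (auto simp: divide_le_eq_1)
  finally show ?thesis .
qed

section \<open>Integration against a density under sign-flipping maps\<close>

text \<open>Here \<open>\<rho> j\<close> is a measure-preserving map that flips the sign of
  \<open>W j\<close> only, and \<open>\<phi>\<close> is the density of the noise. The set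
  \<open>A\<close> restricts attention to points where \<open>\<phi>\<close> can be compared with
  its reflection.\<close>

lemma nn_integral_fdp_le:
  fixes W :: "'p::finite \<Rightarrow> 'a \<Rightarrow> real" and \<phi> :: "'a \<Rightarrow> ennreal"
  assumes [measurable]: "\<And>j. W j \<in> borel_measurable N" "\<phi> \<in> borel_measurable N" "A \<in> sets N"
    and \<phi>: "(\<integral>\<^sup>+x. \<phi> x \<partial>N) \<le> 1" and q: "0 \<le> q"
    and \<rho>[measurable]: "\<And>j. \<rho> j \<in> measurable N N"
    and preserving: "\<And>j. distr N N (\<rho> j) = N"
    and invariant: "\<And>j x. x \<in> A \<Longrightarrow> \<rho> j x \<in> A"
    and W_other: "\<And>j k x. k \<noteq> j \<Longrightarrow> W k (\<rho> j x) = W k x"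
    and W_flip: "\<And>j x. W j (\<rho> j x) = - W j x"
    and le: "\<And>j x. j \<in> H \<Longrightarrow> x \<in> A \<Longrightarrow> 0 < W j x \<Longrightarrow> \<phi> x \<le> \<phi> (\<rho> j x)"
  shows "(\<integral>\<^sup>+x. \<phi> x * ennreal (fdp H (knockoff_select q (\<lambda>j. W j x))) * indicator A x \<partial>N) \<le> ennreal q"
proof -
  note borel_measurable_loo_weight[measurable]
  define L where "L j x = loo_weight q H j (\<lambda>k. W k x)" for j x
  define P where "P j x = (if 0 < W j x then L j x else 0)" for j x
  define M where "M j x = (if W j x < 0 then L j x else 0)" for j x
  have [measurable]: "L j \<in> borel_measurable N" for j
    unfolding L_def by measurable
  have [measurable]: "P j \<in> borel_measurable N" "M j \<in> borel_measurable N" for j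
    unfolding P_def M_def by measurable
  have nonneg: "0 \<le> P j x" "0 \<le> M j x" for j x
    by (simp_all add: P_def M_def L_def loo_weight_nonneg)
  have "L j (\<rho> j x) = L j x" for j x
    unfolding L_def by (rule loo_weight_cong) (simp_all add: W_flip W_other)
  then have flip: "M j (\<rho> j x) = P j x" for j x
    by (simp add: P_def M_def W_flip)
  \<comment> \<open>Where the left integrand is nonzero, \<open>x\<close> is in \<open>A\<close> and
    \<open>0 < W j x\<close>, so passing to \<open>\<rho> j x\<close> does not decrease
    \<open>\<phi>\<close> and turns \<open>P j\<close> into \<open>M j\<close>. The change of
    variables then removes \<open>\<rho> j\<close>.\<close>
  have reflect: "(\<integral>\<^sup>+x. \<phi> x * ennreal (P j x) * indicator A x \<partial>N)
      \<le> (\<integral>\<^sup>+x. \<phi> x * ennreal (M j x) * indicator A x \<partial>N)" if "j \<in> H" for j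
  proof -
    have "(\<integral>\<^sup>+x. \<phi> x * ennreal (P j x) * indicator A x \<partial>N)
        \<le> (\<integral>\<^sup>+x. \<phi> (\<rho> j x) * ennreal (M j (\<rho> j x)) * indicator A (\<rho> j x) \<partial>N)"
    proof (rule nn_integral_mono)
      fix x
      show "\<phi> x * ennreal (P j x) * indicator A x
          \<le> \<phi> (\<rho> j x) * ennreal (M j (\<rho> j x)) * indicator A (\<rho> j x)"
        using le[OF that, of x] invariant[of x j] unfolding flip
        by (cases "x \<in> A \<and> 0 < W j x") (auto simp: P_def intro!: mult_right_mono)
    qed
    also have "\<dots> = (\<integral>\<^sup>+x. \<phi> x * ennreal (M j x) * indicator A x \<partial>distr N N (\<rho> j))"
      by (rule nn_integral_distr[symmetric]) measurable
    finally show ?thesis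
      by (simp add: preserving)
  qed
  have "(\<integral>\<^sup>+x. \<phi> x * ennreal (fdp H (knockoff_select q (\<lambda>j. W j x))) * indicator A x \<partial>N)
      \<le> (\<integral>\<^sup>+x. ennreal q * (\<Sum>j\<in>H. \<phi> x * ennreal (P j x) * indicator A x) \<partial>N)"
  proof (rule nn_integral_mono)
    fix x
    have "ennreal (fdp H (knockoff_select q (\<lambda>j. W j x))) \<le> ennreal (q * (\<Sum>j\<in>H. P j x))"
      unfolding P_def L_def by (intro ennreal_leI fdp_le_sum_loo_weight q)
    also have "\<dots> = ennreal q * (\<Sum>j\<in>H. ennreal (P j x))"
      using q nonneg by (simp add: ennreal_mult' sum_nonneg)
    finally have "\<phi> x * ennreal (fdp H (knockoff_select q (\<lambda>j. W j x))) * indicator A x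
        \<le> \<phi> x * (ennreal q * (\<Sum>j\<in>H. ennreal (P j x))) * indicator A x"
      by (intro mult_right_mono mult_left_mono) auto
    then show "\<phi> x * ennreal (fdp H (knockoff_select q (\<lambda>j. W j x))) * indicator A x
        \<le> ennreal q * (\<Sum>j\<in>H. \<phi> x * ennreal (P j x) * indicator A x)"
      by (simp add: sum_distrib_left sum_distrib_right mult_ac)
  qed
  also have "\<dots> = ennreal q * (\<integral>\<^sup>+x. (\<Sum>j\<in>H. \<phi> x * ennreal (P j x) * indicator A x) \<partial>N)"
    by (rule nn_integral_cmult) measurable
  also have "(\<integral>\<^sup>+x. (\<Sum>j\<in>H. \<phi> x * ennreal (P j x) * indicator A x) \<partial>N)
      = (\<Sum>j\<in>H. \<integral>\<^sup>+x. \<phi> x * ennreal (P j x) * indicator A x \<partial>N)"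
    by (rule nn_integral_sum) measurable
  also have "ennreal q * \<dots> \<le> ennreal q * (\<Sum>j\<in>H. \<integral>\<^sup>+x. \<phi> x * ennreal (M j x) * indicator A x \<partial>N)"
    by (intro mult_left_mono sum_mono reflect) auto
  also have "(\<Sum>j\<in>H. \<integral>\<^sup>+x. \<phi> x * ennreal (M j x) * indicator A x \<partial>N)
      = (\<integral>\<^sup>+x. (\<Sum>j\<in>H. \<phi> x * ennreal (M j x) * indicator A x) \<partial>N)"
    by (rule nn_integral_sum[symmetric]) measurable
  also have "ennreal q * \<dots> \<le> ennreal q * (\<integral>\<^sup>+x. \<phi> x \<partial>N)"
  proof (intro mult_left_mono nn_integral_mono)
    fix x
    have "(\<Sum>j\<in>H. ennreal (M j x)) = ennreal (\<Sum>j\<in>H. M j x)"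
      using nonneg by simp
    also have "\<dots> \<le> 1"
      unfolding M_def L_def ennreal_le_1 by (rule sum_loo_weight_le_1)
    finally have "\<phi> x * (\<Sum>j\<in>H. ennreal (M j x)) * indicator A x \<le> \<phi> x * 1 * 1"
      by (intro mult_mono) (auto simp: indicator_def)
    then show "(\<Sum>j\<in>H. \<phi> x * ennreal (M j x) * indicator A x) \<le> \<phi> x"
      by (simp add: sum_distrib_left sum_distrib_right mult_ac)
  qed simp
  also have "\<dots> \<le> ennreal q * 1"
    by (intro mult_left_mono \<phi>) simp
  finally show ?thesis
    by simp
qed

section \<open>Lebesgue measure and isotropic Gaussians under reflections\<close>

lemma nn_integral_lborel_plus:
  fixes f :: "'a::euclidean_space \<Rightarrow> ennreal"
  assumes [measurable]: "f \<in> borel_measurable borel"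
  shows "(\<integral>\<^sup>+x. f (c + x) \<partial>lborel) = (\<integral>\<^sup>+x. f x \<partial>lborel)"
  by (subst (2) lborel_distr_plus[of c, symmetric]) (simp add: nn_integral_distr)

lemma nn_integral_lborel_minus:
  fixes f :: "'a::euclidean_space \<Rightarrow> ennreal"
  assumes [measurable]: "f \<in> borel_measurable borel"
  shows "(\<integral>\<^sup>+x. f (c - x) \<partial>lborel) = (\<integral>\<^sup>+x. f x \<partial>lborel)"
  by (subst (2) lborel_affine[of "-1" c]) (simp_all add: nn_integral_distr nn_integral_density)

text \<open>The library's \<open>measure_orthogonal_image\<close> requires a well-ordered index type. Here, with \<open>C\<close>
  the unit ball, the integral of \<open>indicator B (f x) * indicator C y\<close> over \<open>x\<close> and \<open>y\<close> is
  transformed by translations into that of \<open>indicator B y * indicator C x\<close>.\<close>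

lemma distr_lborel_orthogonal_transformation:
  fixes f :: "'a::euclidean_space \<Rightarrow> 'a"
  assumes f: "orthogonal_transformation f"
  shows "distr lborel borel f = lborel"
proof (rule measure_eqI)
  fix B assume "B \<in> sets (distr lborel borel f)"
  then have [measurable]: "B \<in> sets borel"
    by simp
  have lin: "linear f"
    using f by (rule orthogonal_transformation_linear)
  have [measurable]: "f \<in> borel_measurable borel"
    using lin by (intro borel_measurable_continuous_onI linear_continuous_on linear_conv_bounded_linear[THEN iffD1])
  \<comment> \<open>The ball is invariant under \<open>f\<close> and has positive finite measure, so
    its measure can be cancelled at the end.\<close>
  define C where "C = (ball 0 1 :: 'a set)"
  have [measurable]: "C \<in> sets borel"
    by (simp add: C_def)
  have C: "indicator C (f x) = (indicator C x :: ennreal)" for x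
    using f by (simp add: C_def indicator_def orthogonal_transformation_norm)
  define b where "b x = (indicator B x :: ennreal)" for x
  define c where "c x = (indicator C x :: ennreal)" for x
  have [measurable]: "b \<in> borel_measurable borel" "c \<in> borel_measurable borel"
    unfolding b_def c_def by measurable
  have "emeasure lborel (f -` B) * emeasure lborel C
      = (\<integral>\<^sup>+x. b (f x) * (\<integral>\<^sup>+y. c y \<partial>lborel) \<partial>lborel)"
  proof -
    have "emeasure lborel (f -` B) = (\<integral>\<^sup>+x. b (f x) \<partial>lborel)"
      unfolding b_def indicator_vimage[symmetric]
      by (rule nn_integral_indicator[symmetric])
        (use measurable_sets[of f borel borel B] in simp)
    then show ?thesis
      by (simp add: nn_integral_multc c_def)
  qed
  also have "\<dots> = (\<integral>\<^sup>+x. b (f x) * (\<integral>\<^sup>+y. c (f x + y) \<partial>lborel) \<partial>lborel)"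
    by (simp add: nn_integral_lborel_plus)
  also have "\<dots> = (\<integral>\<^sup>+x. (\<integral>\<^sup>+y. b (f x) * c (f x + y) \<partial>lborel) \<partial>lborel)"
    by (simp add: nn_integral_cmult)
  also have "\<dots> = (\<integral>\<^sup>+y. (\<integral>\<^sup>+x. b (f x) * c (f x + y) \<partial>lborel) \<partial>lborel)"
    by (rule lborel_pair.Fubini') measurable
  also have "\<dots> = (\<integral>\<^sup>+y. (\<integral>\<^sup>+x. b (f x - y) * c (f x) \<partial>lborel) \<partial>lborel)"
  proof (rule nn_integral_cong)
    fix y
    \<comment> \<open>Writing \<open>y\<close> as \<open>f z\<close> turns the shift by
      \<open>y\<close> into a translation of \<open>x\<close> by \<open>- z\<close>, which moves
      \<open>y\<close> from the argument of \<open>c\<close> to that of \<open>b\<close>.\<close>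
    obtain z where z: "y = f z"
      using orthogonal_transformation_surj[OF f] by (metis surjD)
    have "(\<integral>\<^sup>+x. b (f x) * c (f x + y) \<partial>lborel)
        = (\<integral>\<^sup>+x. b (f (- z + x)) * c (f (- z + x) + y) \<partial>lborel)"
      by (rule nn_integral_lborel_plus[symmetric]) measurable
    then show "(\<integral>\<^sup>+x. b (f x) * c (f x + y) \<partial>lborel) = (\<integral>\<^sup>+x. b (f x - y) * c (f x) \<partial>lborel)"
      by (simp add: z linear_diff[OF lin])
  qed
  also have "\<dots> = (\<integral>\<^sup>+x. (\<integral>\<^sup>+y. b (f x - y) * c (f x) \<partial>lborel) \<partial>lborel)"
    by (rule lborel_pair.Fubini') measurable
  also have "\<dots> = (\<integral>\<^sup>+x. (\<integral>\<^sup>+y. b y \<partial>lborel) * c x \<partial>lborel)"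
    by (simp add: nn_integral_multc nn_integral_lborel_minus c_def C)
  also have "\<dots> = emeasure lborel B * emeasure lborel C"
    by (simp add: nn_integral_cmult b_def c_def)
  finally have "emeasure lborel (f -` B) * emeasure lborel C = emeasure lborel B * emeasure lborel C" .
  moreover have "emeasure lborel C < \<infinity>"
    unfolding C_def by (intro emeasure_bounded_finite bounded_ball)
  moreover have "emeasure lborel C \<noteq> 0"
  proof
    assume "emeasure lborel C = 0"
    then have "emeasure lebesgue C = 0" by simp
    then have "negligible C"
      by (simp add: negligible_iff_emeasure0)
    then show False
      using open_not_negligible[of C] by (simp add: C_def)
  qed
  ultimately have "emeasure lborel (f -` B) = emeasure lborel B"
    by (metis ennreal_mult_cancel_left mult.commute less_irrefl infinity_ennreal_def)
  then show "emeasure (distr lborel borel f) B = emeasure lborel B"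
    by (simp add: emeasure_distr)
qed simp

lemma orthogonal_transformation_reflection:
  fixes u :: "'a::real_inner"
  shows "orthogonal_transformation (\<lambda>x. x - (2 * (u \<bullet> x) / (u \<bullet> u)) *\<^sub>R u)"
  unfolding orthogonal_transformation_def
proof (intro conjI allI)
  show "linear (\<lambda>x. x - (2 * (u \<bullet> x) / (u \<bullet> u)) *\<^sub>R u)"
    by (rule linearI) (simp_all add: inner_add_right add_divide_distrib distrib_left algebra_simps)
  show "(v - (2 * (u \<bullet> v) / (u \<bullet> u)) *\<^sub>R u) \<bullet> (w - (2 * (u \<bullet> w) / (u \<bullet> u)) *\<^sub>R u) = v \<bullet> w" for v w
    \<comment> \<open>For \<open>u = 0\<close> the subtracted vector is zero and the map is the
      identity.\<close>
    by (cases "u = 0") (simp_all add: inner_diff_left inner_diff_right inner_commute field_simps)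
qed

lemma distr_lborel_affine_reflection:
  fixes u t :: "'a::euclidean_space"
  shows "distr lborel borel (\<lambda>x. t + (x - (2 * (u \<bullet> x) / (u \<bullet> u)) *\<^sub>R u)) = lborel"
proof -
  let ?f = "\<lambda>x. x - (2 * (u \<bullet> x) / (u \<bullet> u)) *\<^sub>R u"
  have "distr lborel borel (\<lambda>x. t + ?f x) = distr (distr lborel borel ?f) borel ((+) t)"
    by (subst distr_distr) (simp_all add: comp_def)
  then show ?thesis
    by (simp add: distr_lborel_orthogonal_transformation orthogonal_transformation_reflection lborel_distr_plus)
qed

section \<open>Isotropic Gaussian density\<close>

lemma matrix_inv_eqI:
  fixes A B :: "real^'n^'n"
  assumes "A ** B = mat 1"
  shows "matrix_inv A = B"
proof -
  have BA: "B ** A = mat 1"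
    using assms matrix_left_right_inverse by blast
  have "A ** matrix_inv A = mat 1 \<and> matrix_inv A ** A = mat 1"
    unfolding matrix_inv_def by (rule someI[of _ B]) (use assms BA in simp)
  then show ?thesis
    by (metis BA matrix_mul_assoc matrix_mul_lid matrix_mul_rid)
qed

text \<open>With covariance \<open>mat c\<close> the quadratic form is the squared norm divided by
  \<open>c\<close>, so the density is a decreasing function of the norm.\<close>

lemma mvn_density_isotropic_mono:
  fixes x y :: "real^'n"
  assumes "0 < c" "y \<bullet> y \<le> x \<bullet> x"
  shows "mvn_density 0 (mat c) x \<le> mvn_density 0 (mat c) y"
proof -
  have mat: "mat k = k *\<^sub>R (mat 1 :: real^'n^'n)" for k
    by (simp add: mat_def vec_eq_iff)
  have "mat c ** mat (1 / c) = (mat 1 :: real^'n^'n)"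
    unfolding mat[of c] mat[of "1 / c"]
    using assms(1) by (simp add: scalar_matrix_assoc[symmetric] matrix_scalar_ac)
  then have inv: "matrix_inv (mat c) = (mat (1 / c) :: real^'n^'n)"
    by (rule matrix_inv_eqI)
  have mult: "mat (1 / c) *v z = (1 / c) *\<^sub>R z" for z :: "real^'n"
    unfolding mat[of "1 / c"] by (simp add: scaleR_matrix_vector_assoc[symmetric])
  \<comment> \<open>\<open>sqrt\<close> is negative at negative arguments, so the sign of the
    normalizing denominator has to be checked before dividing.\<close>
  have "0 \<le> det (mat c :: real^'n^'n)"
    using assms(1) by (subst det_diagonal) (simp_all add: mat_def)
  moreover have "y \<bullet> y / c \<le> x \<bullet> x / c"
    using assms by (simp add: divide_right_mono)
  ultimately show ?thesis
    unfolding mvn_density_def by (intro divide_right_mono) (simp_all add: inv mult)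
qed

section \<open>Least squares with knockoffs\<close>

lemma vec_sum_type_eq_iff:
  fixes x y :: "'c^('a::finite + 'b::finite)"
  shows "x = y \<longleftrightarrow> (\<forall>j. x $ Inl j = y $ Inl j) \<and> (\<forall>j. x $ Inr j = y $ Inr j)"
  unfolding vec_eq_iff by (metis sum.exhaust)

lemma vcat_nth [simp]: "vcat u v $ Inl j = u $ j" "vcat u v $ Inr k = v $ k"
  by (simp_all add: vcat_def)

lemma sum_UNIV_sum_type:
  "(\<Sum>k\<in>(UNIV :: ('a::finite + 'b::finite) set). f k) = (\<Sum>i\<in>UNIV. f (Inl i)) + (\<Sum>j\<in>UNIV. f (Inr j))"
  unfolding UNIV_Plus_UNIV[symmetric] by (subst sum.Plus) simp_all

lemma inner_vcat: "vcat u v \<bullet> vcat u' v' = u \<bullet> u' + v \<bullet> v'"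
  by (simp add: inner_vec_def sum_UNIV_sum_type)

lemma hcat_mult_vcat: "hcat A B *v vcat u v = A *v u + B *v v"
  by (simp add: vec_eq_iff matrix_vector_mult_def sum_UNIV_sum_type hcat_def)

lemma transpose_hcat_mult: "transpose (hcat A B) *v y = vcat (transpose A *v y) (transpose B *v y)"
  unfolding vec_sum_type_eq_iff by (simp add: matrix_vector_mult_def transpose_def hcat_def)

lemma inner_transpose_mult: "(A *v x) \<bullet> y = x \<bullet> (transpose A *v (y :: real^'m))"
  for A :: "real^'n^'m"
  by (metis dot_lmul_matrix inner_commute transpose_matrix_vector)

lemma matrix_inv_invertible:
  fixes A :: "real^'n^'n"
  assumes "invertible A"
  shows "A ** matrix_inv A = mat 1" "matrix_inv A ** A = mat 1"
  using someI_ex[OF assms[unfolded invertible_def]] unfolding matrix_inv_def by blast+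

lemma transpose_matrix_inv:
  fixes A :: "real^'n^'n"
  assumes "invertible A"
  shows "transpose (matrix_inv A) = matrix_inv (transpose A)"
  by (rule matrix_inv_eqI[symmetric])
    (metis assms matrix_inv_invertible(2) matrix_transpose_mul transpose_mat)

lemma transpose_diff: "transpose (A - B) = transpose A - (transpose B :: real^'m^'n)"
  by (simp add: transpose_def vec_eq_iff)

lemma transpose_add: "transpose (A + B) = transpose A + (transpose B :: real^'m^'n)"
  by (simp add: transpose_def vec_eq_iff)

lemma matrix_mult_diff_left: "(A - B) ** C = A ** C - (B ** C :: real^'m^'n)"
  by (simp add: matrix_matrix_mult_def vec_eq_iff left_diff_distrib sum_subtractf)

lemma matrix_mult_diff_right: "A ** (B - C) = A ** B - (A ** C :: real^'m^'n)"
  by (simp add: matrix_matrix_mult_def vec_eq_iff right_diff_distrib sum_subtractf)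

lemma matrix_mult_add_left: "(A + B) ** C = A ** C + (B ** C :: real^'m^'n)"
  by (simp add: matrix_matrix_mult_def vec_eq_iff distrib_right sum.distrib)

lemma transpose_diag [simp]: "transpose (diag s) = diag s"
  by (simp add: transpose_def diag_def vec_eq_iff)

lemma diag_mult_axis: "diag s *v axis j 1 = s $ j *\<^sub>R axis j 1"
  unfolding matrix_vector_mult_basis by (simp add: vec_eq_iff column_def diag_def axis_def)

text \<open>With \<open>K\<close> the inverse of \<open>\<Sigma>\<close> and
  \<open>S = diag s\<close>, the difference is \<open>X ** (K ** S) - U ** C\<close>. Orthogonality
  of \<open>U\<close> and \<open>X\<close> gives the first product; in the second, the prescribed
  \<open>transpose C ** C\<close> leaves \<open>(S - S K S) - (2 S - S K S) = - S\<close>.\<close>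

lemma knockoff_difference:
  fixes X Xt U :: "real^'p^'n" and C \<Sigma> :: "real^'p^'p"
  assumes \<Sigma>: "\<Sigma> = transpose X ** X" "invertible \<Sigma>"
    and UU: "transpose U ** U = mat 1" and UX: "transpose U ** X = 0"
    and CC: "transpose C ** C = 2 *\<^sub>R diag s - diag s ** matrix_inv \<Sigma> ** diag s"
    and Xt: "Xt = X ** (mat 1 - matrix_inv \<Sigma> ** diag s) + U ** C"
  shows "transpose X ** (X - Xt) = diag s" "transpose Xt ** (X - Xt) = - diag s"
proof -
  define S where "S = diag s"
  define K where "K = matrix_inv \<Sigma>"
  have "transpose \<Sigma> = \<Sigma>"
    by (simp add: \<Sigma>(1) matrix_transpose_mul)
  then have K_sym: "transpose K = K"
    using \<Sigma>(2) by (simp add: K_def transpose_matrix_inv)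
  have \<Sigma>K: "\<Sigma> ** K = mat 1"
    using \<Sigma>(2) by (simp add: K_def matrix_inv_invertible)
  have XU: "transpose X ** U = 0"
  proof -
    have "transpose X ** U = transpose (transpose U ** X)"
      by (simp add: matrix_transpose_mul)
    also have "\<dots> = 0"
      unfolding UX by (simp add: transpose_def vec_eq_iff)
    finally show ?thesis .
  qed
  have diff: "X - Xt = X ** (K ** S) - U ** C"
    by (simp add: Xt K_def S_def matrix_mult_diff_right)
  have "transpose X ** (X - Xt) = \<Sigma> ** K ** S - (transpose X ** U) ** C"
    unfolding diff matrix_mult_diff_right by (simp add: \<Sigma>(1) matrix_mul_assoc)
  then show X: "transpose X ** (X - Xt) = diag s"
    by (simp add: \<Sigma>K XU S_def)
  have "transpose U ** (X - Xt) = (transpose U ** X) ** (K ** S) - (transpose U ** U) ** C"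
    unfolding diff matrix_mult_diff_right by (simp add: matrix_mul_assoc)
  then have U: "transpose U ** (X - Xt) = - C"
    by (simp add: UU UX)
  have tXt: "transpose Xt = (mat 1 - S ** K) ** transpose X + transpose C ** transpose U"
    by (simp add: Xt transpose_add transpose_diff matrix_transpose_mul K_def[symmetric] S_def[symmetric] K_sym)
      (simp add: S_def)
  have "transpose Xt ** (X - Xt)
      = (mat 1 - S ** K) ** (transpose X ** (X - Xt)) + transpose C ** (transpose U ** (X - Xt))"
    unfolding tXt matrix_mult_add_left by (simp add: matrix_mul_assoc)
  also have "transpose C ** (transpose U ** (X - Xt)) = - (transpose C ** C)"
    unfolding U by (simp add: matrix_matrix_mult_def vec_eq_iff sum_negf)
  also have "(mat 1 - S ** K) ** (transpose X ** (X - Xt)) = S - S ** K ** S"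
    unfolding X matrix_mult_diff_left by (simp add: S_def)
  finally show "transpose Xt ** (X - Xt) = - diag s"
    by (simp add: CC S_def K_def scaleR_2)
qed

section \<open>Least squares and eigenvectors of the Gram matrix\<close>

lemma ols_normal_equations:
  assumes "invertible (transpose A ** A)"
  shows "transpose A *v (A *v ols A x) = transpose A *v x"
  unfolding ols_def using matrix_inv_invertible(1)[OF assms]
  by (metis matrix_vector_mul_assoc matrix_vector_mul_lid)

lemma ols_add_range:
  assumes "invertible (transpose A ** A)"
  shows "ols A (x + A *v z) = ols A x + z"
proof -
  have "matrix_inv (transpose A ** A) *v (transpose A *v (A *v z)) = z"
    using matrix_inv_invertible(2)[OF assms] by (metis matrix_vector_mul_assoc matrix_vector_mul_lid)
  then show ?thesis
    unfolding ols_def by (metis matrix_vector_right_distrib)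
qed

lemma linear_ols: "linear (ols A)"
proof -
  have "ols A = (*v) (matrix_inv (transpose A ** A) ** transpose A)"
    by (simp add: ols_def fun_eq_iff matrix_vector_mul_assoc[symmetric])
  then show ?thesis
    by simp
qed

lemma borel_measurable_ols [measurable]: "ols A \<in> borel_measurable borel"
  using linear_ols
  by (intro borel_measurable_continuous_onI linear_continuous_on linear_conv_bounded_linear[THEN iffD1])

text \<open>By the normal equations, \<open>transpose A *v x\<close> may be replaced by the Gram
  matrix applied to the estimate, and symmetry moves the Gram matrix onto \<open>f\<close>. Thus a
  reflection along \<open>A *v f\<close> sees \<open>x\<close> only through
  \<open>f \<bullet> ols A x\<close>.\<close>

lemma ols_eigenvector:
  fixes A :: "real^'k^'n"
  assumes inv: "invertible (transpose A ** A)" and eigen: "transpose A *v (A *v f) = r *\<^sub>R f"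
  shows "(A *v f) \<bullet> x = r * (f \<bullet> ols A x)" "(A *v f) \<bullet> (A *v f) = r * (f \<bullet> f)" "f \<noteq> 0 \<Longrightarrow> r \<noteq> 0"
proof -
  have "(A *v f) \<bullet> x = f \<bullet> (transpose A *v x)"
    by (rule inner_transpose_mult)
  also have "\<dots> = f \<bullet> (transpose A *v (A *v ols A x))"
    by (simp only: ols_normal_equations[OF inv])
  also have "\<dots> = (A *v f) \<bullet> (A *v ols A x)"
    by (rule inner_transpose_mult[symmetric])
  also have "\<dots> = ols A x \<bullet> (transpose A *v (A *v f))"
    unfolding inner_commute[of "A *v f"] by (rule inner_transpose_mult)
  finally show "(A *v f) \<bullet> x = r * (f \<bullet> ols A x)"
    unfolding eigen by (simp add: inner_commute)
  show "(A *v f) \<bullet> (A *v f) = r * (f \<bullet> f)"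
    unfolding inner_transpose_mult[of A f] eigen by simp
  show "r \<noteq> 0" if "f \<noteq> 0"
  proof
    assume "r = 0"
    with eigen have "(transpose A ** A) *v f = 0"
      by (simp only: matrix_vector_mul_assoc[symmetric]) simp
    then have "f = 0"
      using matrix_inv_invertible(2)[OF inv]
      by (metis matrix_vector_mul_assoc matrix_vector_mul_lid matrix_vector_mult_0_right)
    with that show False
      by simp
  qed
qed

section \<open>Exchanging paired coefficients and the resulting FDR bound\<close>

text \<open>The exchange of the entries at \<open>Inl j\<close> and \<open>Inr j\<close>, written as
  a shift along an eigenvector to match a shift of the noise along its image.\<close>

definition swap_pair :: "'p \<Rightarrow> real^('p::finite + 'p) \<Rightarrow> real^('p + 'p)" where
  "swap_pair j b = b - (b $ Inl j - b $ Inr j) *\<^sub>R vcat (axis j 1) (- axis j 1)"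

lemma swap_pair_nth:
  "swap_pair j b $ Inl k = (if k = j then b $ Inr k else b $ Inl k)"
  "swap_pair j b $ Inr k = (if k = j then b $ Inl k else b $ Inr k)"
  by (simp_all add: swap_pair_def axis_def)

text \<open>Here \<open>b\<close> is the shifted estimate as a function of the noise, and
  \<open>\<mu> j\<close> is the value of the paired difference at zero noise, up to the reflection's
  fixed hyperplane. On the swap-invariant set \<open>E\<close> the reflection argument yields
  \<open>q\<close>; off \<open>E\<close> the proportion is at most 1.\<close>

lemma knockoff_FDR_le:
  fixes W :: "'p::finite \<Rightarrow> real^('p + 'p) \<Rightarrow> real" and b :: "real^'n \<Rightarrow> real^('p + 'p)"
    and w :: "'w \<Rightarrow> real^'n" and u :: "'p \<Rightarrow> real^'n" and r \<mu> :: "'p \<Rightarrow> real"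
  assumes "prob_space M" and c: "0 < c" and q: "0 \<le> q"
    and w: "distributed M lborel w (\<lambda>x. ennreal (mvn_density 0 (mat c) x))"
    and [measurable]: "b \<in> borel_measurable borel" "\<And>j. W j \<in> borel_measurable borel" "E \<in> sets borel"
    and r: "\<And>j. 0 < r j" and uu: "\<And>j. u j \<bullet> u j = 2 * r j"
    and ux: "\<And>j x. u j \<bullet> x = r j * (b x $ Inl j - b x $ Inr j - \<mu> j)"
    and swap: "\<And>j x. b (x - (b x $ Inl j - b x $ Inr j) *\<^sub>R u j) = swap_pair j (b x)"
    and W_other: "\<And>j k z. k \<noteq> j \<Longrightarrow> W k (swap_pair j z) = W k z"
    and W_flip: "\<And>j z. W j (swap_pair j z) = - W j z"
    and E_swap: "\<And>j z. z \<in> E \<Longrightarrow> swap_pair j z \<in> E"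
    and E_pos: "\<And>j z. j \<in> H \<Longrightarrow> z \<in> E \<Longrightarrow> 0 < W j z \<Longrightarrow> z $ Inr j < z $ Inl j"
    and null: "\<And>j. j \<in> H \<Longrightarrow> \<mu> j \<le> 0"
  shows "FDR M H (\<lambda>\<omega>. knockoff_select q (\<lambda>j. W j (b (w \<omega>))))
    \<le> q + measure M {\<omega> \<in> space M. b (w \<omega>) \<notin> E}"
proof -
  interpret prob_space M by fact
  define d where "d j x = b x $ Inl j - b x $ Inr j" for j x
  define \<rho> where "\<rho> j x = x - d j x *\<^sub>R u j" for j x
  define \<phi> where "\<phi> x = ennreal (mvn_density 0 (mat c) (x :: real^'n))" for x
  define F where "F x = fdp H (knockoff_select q (\<lambda>j. W j (b x)))" for x
  define A where "A = b -` E"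
  have w_meas[measurable]: "w \<in> borel_measurable M"
    using distributed_measurable[OF w] by simp
  have [measurable]: "\<phi> \<in> borel_measurable borel"
    using distributed_borel_measurable[OF w] by (simp add: \<phi>_def[abs_def])
  have [measurable]: "F \<in> borel_measurable borel"
    unfolding F_def by (rule borel_measurable_fdp) measurable
  have [measurable]: "A \<in> sets borel"
    unfolding A_def using measurable_sets[of b borel borel E] by simp
  \<comment> \<open>Since \<open>u j \<bullet> x = r j * (d j x - \<mu> j)\<close> and
    \<open>u j \<bullet> u j = 2 * r j\<close>, the linear reflection subtracts
    \<open>d j x - \<mu> j\<close> times \<open>u j\<close>; the translation supplies the remaining
    \<open>\<mu> j\<close>.\<close>
  have \<rho>_reflection: "\<rho> j = (\<lambda>x. - \<mu> j *\<^sub>R u j + (x - (2 * (u j \<bullet> x) / (u j \<bullet> u j)) *\<^sub>R u j))" for j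
  proof
    fix x
    have eq: "2 * (u j \<bullet> x) / (u j \<bullet> u j) = d j x - \<mu> j"
      using r[of j] unfolding uu ux[of j x] by (simp add: d_def)
    show "\<rho> j x = - \<mu> j *\<^sub>R u j + (x - (2 * (u j \<bullet> x) / (u j \<bullet> u j)) *\<^sub>R u j)"
      unfolding eq by (simp add: \<rho>_def algebra_simps)
  qed
  have b_\<rho>: "b (\<rho> j x) = swap_pair j (b x)" for j x
    unfolding \<rho>_def d_def by (rule swap)
  have density_mono: "\<phi> x \<le> \<phi> (\<rho> j x)" if "j \<in> H" "0 < d j x" for j x
  proof -
    \<comment> \<open>The terms quadratic in \<open>d j x\<close> cancel. The change of squared norm
      is \<open>2 * d j x * r j * \<mu> j\<close>, nonpositive for a null with positive
      difference.\<close>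
    have "\<rho> j x \<bullet> \<rho> j x = x \<bullet> x - 2 * d j x * (u j \<bullet> x) + (d j x)\<^sup>2 * (u j \<bullet> u j)"
      by (simp add: \<rho>_def inner_diff_left inner_diff_right inner_commute power2_eq_square algebra_simps)
    also have "\<dots> = x \<bullet> x + 2 * (d j x * r j) * \<mu> j"
      unfolding uu ux[of j x] d_def[symmetric] by (simp add: power2_eq_square algebra_simps)
    also have "\<dots> \<le> x \<bullet> x"
      using that r[of j] null[of j] by (simp add: mult_nonneg_nonpos)
    finally show ?thesis
      unfolding \<phi>_def by (intro ennreal_leI mvn_density_isotropic_mono c)
  qed
  have "(\<integral>\<^sup>+x. \<phi> x * ennreal (F x) * indicator A x \<partial>lborel) \<le> ennreal q"
    unfolding F_def
  proof (rule nn_integral_fdp_le[where \<rho> = \<rho>])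
    have "(\<integral>\<^sup>+x. \<phi> x * 1 \<partial>lborel) = (\<integral>\<^sup>+\<omega>. 1 \<partial>M)"
      unfolding \<phi>_def by (rule distributed_nn_integral[OF w]) simp
    then show "(\<integral>\<^sup>+x. \<phi> x \<partial>lborel) \<le> 1"
      by (simp add: emeasure_space_1)
    show "\<rho> j \<in> lborel \<rightarrow>\<^sub>M lborel" for j
      unfolding \<rho>_reflection by measurable
    have "distr lborel lborel (\<rho> j) = distr lborel borel (\<rho> j)" for j
      by (rule distr_cong) simp_all
    then show "distr lborel lborel (\<rho> j) = lborel" for j
      unfolding \<rho>_reflection by (simp only: distr_lborel_affine_reflection)
    show "\<rho> j x \<in> A" if "x \<in> A" for j x
      using that E_swap by (simp add: A_def b_\<rho>)
    show "\<phi> x \<le> \<phi> (\<rho> j x)" if "j \<in> H" "x \<in> A" "0 < W j (b x)" for j x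
      using that E_pos[of j "b x"] by (intro density_mono) (auto simp: A_def d_def)
  qed (simp_all add: b_\<rho> W_other W_flip q)
  moreover have "(\<integral>\<^sup>+x. \<phi> x * ennreal (F x) * indicator A x \<partial>lborel)
      = (\<integral>\<^sup>+\<omega>. ennreal (F (w \<omega>)) * indicator A (w \<omega>) \<partial>M)"
    unfolding \<phi>_def mult.assoc by (rule distributed_nn_integral[OF w]) measurable
  ultimately have on_A: "(\<integral>\<^sup>+\<omega>. ennreal (F (w \<omega>)) * indicator A (w \<omega>) \<partial>M) \<le> ennreal q"
    by simp
  have F_bounds: "0 \<le> F x" "F x \<le> 1" for x
    by (simp_all add: F_def fdp_nonneg fdp_le_1)
  have N: "{\<omega> \<in> space M. b (w \<omega>) \<notin> E} \<in> sets M"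
    by measurable
  have "ennreal (FDR M H (\<lambda>\<omega>. knockoff_select q (\<lambda>j. W j (b (w \<omega>))))) = ennreal (\<integral>\<omega>. F (w \<omega>) \<partial>M)"
    by (simp add: FDR_def F_def fdp_def)
  also have "\<dots> = (\<integral>\<^sup>+\<omega>. ennreal (F (w \<omega>)) \<partial>M)"
    using F_bounds by (intro nn_integral_eq_integral[symmetric] integrable_const_bound[of _ 1]) auto
  also have "\<dots> \<le> (\<integral>\<^sup>+\<omega>. ennreal (F (w \<omega>)) * indicator A (w \<omega>)
      + indicator {\<omega> \<in> space M. b (w \<omega>) \<notin> E} \<omega> \<partial>M)"
    using F_bounds by (intro nn_integral_mono) (auto simp: A_def indicator_def)
  also have "\<dots> = (\<integral>\<^sup>+\<omega>. ennreal (F (w \<omega>)) * indicator A (w \<omega>) \<partial>M)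
      + emeasure M {\<omega> \<in> space M. b (w \<omega>) \<notin> E}"
    by (subst nn_integral_add) (use N in simp_all)
  also have "\<dots> \<le> ennreal q + ennreal (measure M {\<omega> \<in> space M. b (w \<omega>) \<notin> E})"
    by (intro add_mono on_A) (simp add: emeasure_eq_measure)
  also have "\<dots> = ennreal (q + measure M {\<omega> \<in> space M. b (w \<omega>) \<notin> E})"
    using q by simp
  finally show ?thesis
    by (rule ennreal_le_iff[THEN iffD1, rotated]) (simp add: q)
qed

section \<open>FDR bounds for the one-sided and the approximate two-sided test\<close>

theorem theorem2:
  fixes M :: "'w measure"
    and X Xt U :: "real^'p^'n" and C :: "real^'p^'p" and \<Sigma> :: "real^'p^'p"
    and s \<beta> \<delta> :: "real^'p" and \<sigma> q :: real
    and w y :: "'w \<Rightarrow> real^'n"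
    and bhat :: "'w \<Rightarrow> real^('p + 'p)"
    and W :: "'p \<Rightarrow> real^('p + 'p) \<Rightarrow> real"
  assumes "prob_space M"
    and "\<sigma>\<^sup>2 > 0"
    and "distributed M lborel w (\<lambda>x. ennreal (mvn_density 0 (mat (\<sigma>\<^sup>2)) x))"
    and "\<And>\<omega>. y \<omega> = X *v \<beta> + w \<omega>"
    and "2 * CARD('p) \<le> CARD('n)"
    and "\<And>j. norm (column j X) = 1"
    and "\<Sigma> = transpose X ** X" and "invertible \<Sigma>"
    and "\<And>j. 0 \<le> s $ j" and "loewner_le (diag s) (2 *\<^sub>R \<Sigma>)"
    and "transpose U ** U = mat 1" and "transpose U ** X = 0"
    and "transpose C ** C = 2 *\<^sub>R diag s - diag s ** matrix_inv \<Sigma> ** diag s"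
    and "Xt = X ** (mat 1 - matrix_inv \<Sigma> ** diag s) + U ** C"
    and "invertible (transpose (hcat X Xt) ** hcat X Xt)"
    and "0 \<le> q" "q \<le> 1"
    and "\<And>j. 0 \<le> \<delta> $ j"
    and "\<And>\<omega>. bhat \<omega> = ols (hcat X Xt) (y \<omega>) + vcat 0 \<delta>"
    and "\<And>j. W j \<in> borel_measurable borel"
    and "\<And>j b b'. {b $ Inl j, b $ Inr j} = {b' $ Inl j, b' $ Inr j} \<Longrightarrow> \<bar>W j b\<bar> = \<bar>W j b'\<bar>"
  shows "((\<forall>j b. sgn (W j b) = sgn (b $ Inl j - b $ Inr j)) \<longrightarrow>
            FDR M {j. \<beta> $ j \<le> \<delta> $ j} (\<lambda>\<omega>. knockoff_select q (\<lambda>j. W j (bhat \<omega>))) \<le> q)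
       \<and> ((\<forall>j b. sgn (W j b) = sgn (\<bar>b $ Inl j\<bar> - \<bar>b $ Inr j\<bar>)) \<longrightarrow>
            FDR M {j. \<bar>\<beta> $ j\<bar> \<le> \<delta> $ j} (\<lambda>\<omega>. knockoff_select q (\<lambda>j. W j (bhat \<omega>)))
              \<le> q + measure M {\<omega> \<in> space M.
                  (INF j\<in>{j. \<bar>\<beta> $ j\<bar> \<le> \<delta> $ j}. ereal (bhat \<omega> $ Inl j + bhat \<omega> $ Inr j)) < 0})"
proof -
  let ?A = "hcat X Xt"
  define e where "e j = vcat (axis j 1) (- axis j 1)" for j :: 'p
  define u where "u j = ?A *v e j" for j
  \<comment> \<open>The fitted part \<open>X *v \<beta>\<close> adds \<open>vcat \<beta> 0\<close>
    to the estimate, so this is \<open>bhat\<close> as a function of the noise. The pair at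
    \<open>j\<close> is centred at \<open>\<beta> $ j\<close> and
    \<open>\<delta> $ j\<close>.\<close>
  define b where "b x = ols ?A x + vcat \<beta> \<delta>" for x
  note inv = assms(15)
  have diff: "transpose X ** (X - Xt) = diag s" "transpose Xt ** (X - Xt) = - diag s"
    using knockoff_difference[OF assms(7,8,11-14)] by auto
  have eigen: "transpose ?A *v (?A *v e j) = s $ j *\<^sub>R e j" for j
  proof -
    have "?A *v e j = (X - Xt) *v axis j 1"
      unfolding e_def hcat_mult_vcat by (simp add: vec.neg matrix_vector_mult_diff_rdistrib)
    then have "transpose ?A *v (?A *v e j)
        = vcat (transpose X ** (X - Xt) *v axis j 1) (transpose Xt ** (X - Xt) *v axis j 1)"
      by (simp only: transpose_hcat_mult matrix_vector_mul_assoc[symmetric])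
    also have "\<dots> = vcat (s $ j *\<^sub>R axis j 1) (- (s $ j *\<^sub>R axis j 1))"
      unfolding diff diag_mult_axis[symmetric] by (simp add: vec_sum_type_eq_iff) (simp add: matrix_vector_mult_def sum_negf)
    finally show ?thesis
      by (simp add: vec_sum_type_eq_iff e_def)
  qed
  have ee: "e j \<bullet> e j = 2" for j
    by (simp add: e_def inner_vcat inner_axis_axis)
  have e_inner: "e j \<bullet> z = z $ Inl j - z $ Inr j" for j z
  proof -
    have "e j \<bullet> vcat (\<chi> k. z $ Inl k) (\<chi> k. z $ Inr k) = z $ Inl j - z $ Inr j"
      by (simp add: e_def inner_vcat inner_axis')
    also have "vcat (\<chi> k. z $ Inl k) (\<chi> k. z $ Inr k) = z"
      by (simp add: vec_sum_type_eq_iff)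
    finally show ?thesis .
  qed
  \<comment> \<open>\<open>s $ j\<close> is an eigenvalue of the invertible Gram matrix, so it
    cannot vanish.\<close>
  have s_pos: "0 < s $ j" for j
  proof -
    have "e j \<noteq> 0"
      using ee[of j] by auto
    from ols_eigenvector(3)[OF inv eigen this] assms(9)[of j] show ?thesis
      by simp
  qed
  have uu: "u j \<bullet> u j = 2 * s $ j" for j
    unfolding u_def by (simp add: ols_eigenvector(2)[OF inv eigen] ee)
  have ux: "u j \<bullet> x = s $ j * (b x $ Inl j - b x $ Inr j - (\<beta> $ j - \<delta> $ j))" for j x
    unfolding u_def by (simp add: ols_eigenvector(1)[OF inv eigen] e_inner b_def)
  have swap: "b (x - (b x $ Inl j - b x $ Inr j) *\<^sub>R u j) = swap_pair j (b x)" for j x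
  proof -
    have "b (x + c *\<^sub>R u j) = b x + c *\<^sub>R e j" for c
      unfolding b_def u_def matrix_vector_mult_scaleR[symmetric] ols_add_range[OF inv] by simp
    from this[of "- (b x $ Inl j - b x $ Inr j)"] show ?thesis
      unfolding swap_pair_def e_def scaleR_minus_left by simp
  qed
  have b: "b \<in> borel_measurable borel"
    unfolding b_def by measurable
  have bhat: "bhat \<omega> = b (w \<omega>)" for \<omega>
  proof -
    have "y \<omega> = w \<omega> + ?A *v vcat \<beta> 0"
      by (simp add: assms(4) hcat_mult_vcat)
    then have "bhat \<omega> = ols ?A (w \<omega>) + vcat \<beta> 0 + vcat 0 \<delta>"
      by (simp add: assms(19) ols_add_range[OF inv])
    then show ?thesis
      by (simp add: b_def vec_sum_type_eq_iff)
  qed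
  \<comment> \<open>Both parts at once: \<open>g\<close> is the antisymmetric contrast giving the
    sign of \<open>W j\<close>. On \<open>E\<close> its positivity must imply that the first entry
    of the pair exceeds the second.\<close>
  have FDR_le: "FDR M H (\<lambda>\<omega>. knockoff_select q (\<lambda>j. W j (bhat \<omega>)))
      \<le> q + measure M {\<omega> \<in> space M. bhat \<omega> \<notin> E}"
    if sgn: "\<And>j z. sgn (W j z) = sgn (g (z $ Inl j) (z $ Inr j))" and g: "\<And>l r. g l r = - g r l"
      and E: "E \<in> sets borel" "\<And>j z. z \<in> E \<Longrightarrow> swap_pair j z \<in> E"
      and pos: "\<And>j z. j \<in> H \<Longrightarrow> z \<in> E \<Longrightarrow> 0 < g (z $ Inl j) (z $ Inr j) \<Longrightarrow> z $ Inr j < z $ Inl j"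
      and H: "\<And>j. j \<in> H \<Longrightarrow> \<beta> $ j \<le> \<delta> $ j"
    for g :: "real \<Rightarrow> real \<Rightarrow> real" and E H
  proof -
    have W_eq: "W j z = sgn (g (z $ Inl j) (z $ Inr j)) * \<bar>W j z\<bar>" for j z
      unfolding sgn[symmetric] by (rule sgn_mult_abs[symmetric])
    have abs: "\<bar>W k (swap_pair j z)\<bar> = \<bar>W k z\<bar>" for j k z
      by (rule assms(21)) (auto simp: swap_pair_nth)
    have other: "W k (swap_pair j z) = W k z" if "k \<noteq> j" for j k z
      using that by (subst (1 2) W_eq) (simp add: abs swap_pair_nth)
    have flip: "W j (swap_pair j z) = - W j z" for j z
      by (subst (1 2) W_eq) (simp add: abs swap_pair_nth g[of "z $ Inr j"] sgn_minus)
    show ?thesis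
      unfolding bhat
    proof (rule knockoff_FDR_le[where u = u and r = "\<lambda>j. s $ j" and \<mu> = "\<lambda>j. \<beta> $ j - \<delta> $ j"
          and c = "\<sigma>\<^sup>2"])
      show "z $ Inr j < z $ Inl j" if "j \<in> H" "z \<in> E" "0 < W j z" for j z
        using that sgn[of j z] by (intro pos) (auto simp: sgn_if split: if_splits)
    qed (fact | simp add: H)+
  qed
  show ?thesis
  proof (intro conjI impI)
    assume sgn: "\<forall>j z. sgn (W j z) = sgn (z $ Inl j - z $ Inr j)"
    have "FDR M {j. \<beta> $ j \<le> \<delta> $ j} (\<lambda>\<omega>. knockoff_select q (\<lambda>j. W j (bhat \<omega>)))
        \<le> q + measure M {\<omega> \<in> space M. bhat \<omega> \<notin> UNIV}"
      \<comment> \<open>With \<open>E = UNIV\<close> the exceptional event is empty.\<close>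
      by (rule FDR_le[where g = "\<lambda>l r. l - r"]) (simp_all add: sgn)
    then show "FDR M {j. \<beta> $ j \<le> \<delta> $ j} (\<lambda>\<omega>. knockoff_select q (\<lambda>j. W j (bhat \<omega>))) \<le> q"
      by simp
  next
    assume sgn: "\<forall>j z. sgn (W j z) = sgn (\<bar>z $ Inl j\<bar> - \<bar>z $ Inr j\<bar>)"
    let ?H = "{j. \<bar>\<beta> $ j\<bar> \<le> \<delta> $ j}"
    \<comment> \<open>Sums of pairs are unchanged by swaps, and a nonnegative sum makes a larger
      absolute value on the left a larger value.\<close>
    let ?E = "{z :: real^('p + 'p). \<forall>j\<in>?H. 0 \<le> z $ Inl j + z $ Inr j}"
    have "?E = (\<Inter>j\<in>?H. {z. 0 \<le> z $ Inl j + z $ Inr j})"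
      by auto
    also have "\<dots> \<in> sets borel"
      by (intro borel_closed closed_INT ballI closed_Collect_le continuous_intros)
    finally have E: "?E \<in> sets borel" .
    have "FDR M ?H (\<lambda>\<omega>. knockoff_select q (\<lambda>j. W j (bhat \<omega>)))
        \<le> q + measure M {\<omega> \<in> space M. bhat \<omega> \<notin> ?E}"
    proof (rule FDR_le[where g = "\<lambda>l r. \<bar>l\<bar> - \<bar>r\<bar>"])
      show "swap_pair j z \<in> ?E" if "z \<in> ?E" for j z
        using that by (auto simp: swap_pair_nth add.commute)
      show "z $ Inr j < z $ Inl j"
        if "j \<in> ?H" "z \<in> ?E" "0 < \<bar>z $ Inl j\<bar> - \<bar>z $ Inr j\<bar>" for j z
      proof -
        have "0 \<le> z $ Inl j + z $ Inr j"
          using that by blast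
        with that(3) show ?thesis
          by linarith
      qed
    qed (use sgn E in simp_all)
    \<comment> \<open>If there are no nulls, the infimum is \<open>\<infinity>\<close> and
      \<open>?E\<close> is everything, so both sides are false.\<close>
    moreover have "bhat \<omega> \<notin> ?E \<longleftrightarrow> (INF j\<in>?H. ereal (bhat \<omega> $ Inl j + bhat \<omega> $ Inr j)) < 0" for \<omega>
      by (auto simp: INF_less_iff not_le)
    ultimately show "FDR M ?H (\<lambda>\<omega>. knockoff_select q (\<lambda>j. W j (bhat \<omega>)))
        \<le> q + measure M {\<omega> \<in> space M. (INF j\<in>?H. ereal (bhat \<omega> $ Inl j + bhat \<omega> $ Inr j)) < 0}"
      by simp
  qed
qed

end
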